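(* Let $G=(V,E,s)$ be a graph in which every node is reachable from $s$, and let its A-C tree map each node $a\in V$ to the sequence $S^a_1,\dots,S^a_{k_a}$ of strongly connected components of $G_a$ in topological order. Then the family of sets $$AC:=\Big\{\{a\}\cup\bigcup_{i=1}^{j} D(S^a_i) : a\in V,\ j\in\{1,\dots,k_a\}\Big\}$$ is a nesting decomposition of $G$ of minimum width, i.e. its width equals the nesting width $\mathrm{nw}(G)$.
   Context: A graph is a tuple $G=(V,E,s)$ with $V$ a finite set of nodes, $E\subseteq V\times V$ a set of arcs and $s\in V$ a source; all nodes are reachable from $s$. Node $a$ dominates node $b$ (written $a\geq_s b$) if every path from $s$ to $b$ contains $a$; this is a partial order whose Hasse diagram (transitive reduction) is a tree rooted at $s$, the dominator tree $T$. For a node $a$, $C(a)$ denotes its children in $T$ and $D(a)$ its descendants in $T$ (including $a$ itself). For each $a$, $G_a$ is the directed graph with node set $C(a)$ and an arc $(u,v)$ whenever $u\neq v$ and there is an arc of $G$ from a node of $D(u)$ to a node of $D(v)$ with both endpoints in $D(a)$ (i.e. in the induced subgraph $G[D(a)]$). The A-C tree of $G$ maps each $a$ to the strongly connected components $S^a_1,\dots,S^a_{k_a}$ of $G_a$ listed in a topological order (a fixed but arbitrary one). For a set $S\subseteq C(a)$, $D(S)=\bigcup_{v\in S}D(v)$. A module of $G$ is a set $M\subseteq V$ having some $m\in M$ such that every arc $(u,v)$ with $u\notin M$, $v\in M$ has $v=m$; by convention a set containing $s$ is a module iff it is a module with source $s$. The trivial modules are $V$ and the singletons $\{v\}$. A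 nesting decomposition of $G$ is a collection of pairwise non-overlapping modules (any two are disjoint or one contains the other) that contains all trivial modules. For a module $M$ in a nesting decomposition $F$, its maximal module partition consists of those $H\in F$ with $H\subsetneq M$ and no $K\in F$ with $H\subsetneq K\subsetneq M$. The width of $F$ is the maximum size of the maximal module partition over modules of $F$; the nesting width $\mathrm{nw}(G)$ is the minimum width over all nesting decompositions of $G$.
   Formalization: As printed (j ≥ 1), AC contains no singletons and so is never a nesting decomposition; the formal theorem proves both claims for AC together with the trivial modules V and {v} (equivalently, allowing j = 0). *)

theory Defs
  imports "Graph_Theory.Graph_Theory"
begin

text \<open>Loops are allowed, and so are arcs into the source.\<close>

locale source_digraph = pair_fin_digraph G
  for G :: "'a pair_pre_digraph" +
  fixes s :: 'a
  assumes source_in_verts: "s \<in> pverts G"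
    and all_reachable: "\<And>v. v \<in> pverts G \<Longrightarrow> s \<rightarrow>\<^sup>*\<^bsub>with_proj G\<^esub> v"

definition dominator :: "'a pair_pre_digraph \<Rightarrow> 'a \<Rightarrow> 'a \<Rightarrow> 'a \<Rightarrow> bool" where
  "dominator G s a b \<longleftrightarrow> a \<in> pverts G \<and> b \<in> pverts G \<and>
     (\<forall>p. pre_digraph.apath (with_proj G) s p b \<longrightarrow>
          a \<in> set (pre_digraph.awalk_verts (with_proj G) s p))"

definition strict_dominator :: "'a pair_pre_digraph \<Rightarrow> 'a \<Rightarrow> 'a \<Rightarrow> 'a \<Rightarrow> bool" where
  "strict_dominator G s a b \<longleftrightarrow> dominator G s a b \<and> a \<noteq> b"

text \<open>The transitive reduction of dominance, with arcs pointing from parent to child.\<close>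

definition dominator_tree :: "'a pair_pre_digraph \<Rightarrow> 'a \<Rightarrow> 'a pair_pre_digraph" where
  "dominator_tree G s = \<lparr> pverts = pverts G,
     parcs = {(a, b). strict_dominator G s a b \<and>
       \<not> (\<exists>c. strict_dominator G s a c \<and> strict_dominator G s c b)} \<rparr>"

definition children :: "'a pair_pre_digraph \<Rightarrow> 'a \<Rightarrow> 'a \<Rightarrow> 'a set" where
  "children G s a = {b. (a, b) \<in> parcs (dominator_tree G s)}"

definition descendants :: "'a pair_pre_digraph \<Rightarrow> 'a \<Rightarrow> 'a \<Rightarrow> 'a set" where
  "descendants G s a = {b. a \<rightarrow>\<^sup>*\<^bsub>with_proj (dominator_tree G s)\<^esub> b}"

definition descendants_of_set :: "'a pair_pre_digraph \<Rightarrow> 'a \<Rightarrow> 'a set \<Rightarrow> 'a set" where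
  "descendants_of_set G s S = (\<Union>v\<in>S. descendants G s v)"

definition child_graph :: "'a pair_pre_digraph \<Rightarrow> 'a \<Rightarrow> 'a \<Rightarrow> 'a pair_pre_digraph" where
  "child_graph G s a = \<lparr> pverts = children G s a,
     parcs = {(u, v). u \<in> children G s a \<and> v \<in> children G s a \<and> u \<noteq> v \<and>
       (\<exists>x y. (x, y) \<in> parcs G \<and> x \<in> descendants G s a \<and> y \<in> descendants G s a \<and>
          x \<in> descendants G s u \<and> y \<in> descendants G s v)} \<rparr>"

text \<open>
  Arcs between distinct components lead from earlier to later list entries.
  Indices are shifted: the \<open>i\<close>-th component is \<open>Ss ! (i - 1)\<close>.
\<close>

definition topological_scc_list :: "'a pair_pre_digraph \<Rightarrow> 'a set list \<Rightarrow> bool" where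
  "topological_scc_list H Ss \<longleftrightarrow> distinct Ss \<and>
     set Ss = pre_digraph.sccs_verts (with_proj H) \<and>
     (\<forall>i j. i < j \<and> j < length Ss \<longrightarrow>
        \<not> (\<exists>u\<in>Ss ! j. \<exists>v\<in>Ss ! i. (u, v) \<in> parcs H))"

definition AC_tree :: "'a pair_pre_digraph \<Rightarrow> 'a \<Rightarrow> ('a \<Rightarrow> 'a set list) \<Rightarrow> bool" where
  "AC_tree G s S \<longleftrightarrow> (\<forall>a\<in>pverts G. topological_scc_list (child_graph G s a) (S a))"

text \<open>
  As \<open>j\<close> starts at 1, this family contains no singletons (and is empty if the source is the
  only node). A decomposition obtained from it needs the trivial
  modules adjoined, which amounts to admitting \<open>j = 0\<close> as well.
\<close>

definition AC_family :: "'a pair_pre_digraph \<Rightarrow> 'a \<Rightarrow> ('a \<Rightarrow> 'a set list) \<Rightarrow> 'a set set" where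
  "AC_family G s S =
     {{a} \<union> (\<Union>i\<in>{1..j}. descendants_of_set G s (S a ! (i - 1))) | a j.
        a \<in> pverts G \<and> j \<in> {1..length (S a)}}"

definition module_with_source :: "'a pair_pre_digraph \<Rightarrow> 'a \<Rightarrow> 'a set \<Rightarrow> bool" where
  "module_with_source G m M \<longleftrightarrow> M \<subseteq> pverts G \<and> m \<in> M \<and>
     (\<forall>u v. (u, v) \<in> parcs G \<and> u \<notin> M \<and> v \<in> M \<longrightarrow> v = m)"

definition is_module :: "'a pair_pre_digraph \<Rightarrow> 'a \<Rightarrow> 'a set \<Rightarrow> bool" where
  "is_module G s M \<longleftrightarrow>
     (if s \<in> M then module_with_source G s M else \<exists>m. module_with_source G m M)"

definition trivial_modules :: "'a pair_pre_digraph \<Rightarrow> 'a set set" where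
  "trivial_modules G = insert (pverts G) {{v} | v. v \<in> pverts G}"

definition nesting_decomposition :: "'a pair_pre_digraph \<Rightarrow> 'a \<Rightarrow> 'a set set \<Rightarrow> bool" where
  "nesting_decomposition G s F \<longleftrightarrow> (\<forall>M\<in>F. is_module G s M) \<and>
     (\<forall>M\<in>F. \<forall>N\<in>F. M \<inter> N = {} \<or> M \<subseteq> N \<or> N \<subseteq> M) \<and>
     trivial_modules G \<subseteq> F"

definition maximal_module_partition :: "'a set set \<Rightarrow> 'a set \<Rightarrow> 'a set set" where
  "maximal_module_partition F M = {H \<in> F. H \<subset> M \<and> \<not> (\<exists>K\<in>F. H \<subset> K \<and> K \<subset> M)}"

definition decomposition_width :: "'a set set \<Rightarrow> nat" where
  "decomposition_width F = Max ((\<lambda>M. card (maximal_module_partition F M)) ` F)"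

definition nesting_width :: "'a pair_pre_digraph \<Rightarrow> 'a \<Rightarrow> nat" where
  "nesting_width G s = Min (decomposition_width ` {F. nesting_decomposition G s F})"

end

theory Submission
  imports Defs
begin

text \<open>
  A member \<open>{a} \<union> D(S\<^sub>1) \<union> \<dots> \<union> D(S\<^sub>j)\<close> of the A-C family splits into the member for \<open>j - 1\<close> and the
  sets \<open>D(v)\<close> with \<open>v \<in> S\<^sub>j\<close>, hence into at most \<open>1 + card S\<^sub>j\<close> parts. No nesting decomposition can
  avoid as many parts: for \<open>C = S\<^sub>j\<close>, take a minimal member \<open>M\<close> with \<open>{a} \<union> C \<subseteq> M\<close>. A member properly
  inside \<open>M\<close> contains at most one element of \<open>{a} \<union> C\<close>, because a module is closed under the
  dominators of its elements that do not dominate its source, and \<open>C\<close> is strongly connected. So the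
  elements of \<open>{a} \<union> C\<close> lie in \<open>1 + card C\<close> distinct parts of \<open>M\<close>.
\<close>

section \<open>Dominance\<close>

text \<open>
  Negated dominance is reachability in \<open>G\<close> with one node deleted. All facts about dominance are
  inductions over this predicate, so that no paths have to be spliced.
\<close>

inductive reach_avoiding :: "('a \<times> 'a) set \<Rightarrow> 'a \<Rightarrow> 'a \<Rightarrow> 'a \<Rightarrow> bool" for E s a where
  start: "s \<noteq> a \<Longrightarrow> reach_avoiding E s a s"
| step: "reach_avoiding E s a x \<Longrightarrow> (x, y) \<in> E \<Longrightarrow> y \<noteq> a \<Longrightarrow> reach_avoiding E s a y"

lemma not_reach_avoiding_self: "\<not> reach_avoiding E s a a"
proof -
  have "b \<noteq> a" if "reach_avoiding E s a b" for b
    using that by induction auto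
  then show ?thesis by blast
qed

text \<open>A walk to \<open>c\<close> either meets \<open>b\<close>, so that an initial piece
  reaches \<open>b\<close>, or misses it altogether. The contrapositive is transitivity of
  dominance.\<close>

lemma reach_avoiding_cases_via:
  "reach_avoiding E s a c \<Longrightarrow> reach_avoiding E s a b \<or> reach_avoiding E s b c"
  by (induction rule: reach_avoiding.induct) (metis reach_avoiding.intros)+

context source_digraph
begin

abbreviation dom :: "'a \<Rightarrow> 'a \<Rightarrow> bool" where "dom \<equiv> dominator G s"
abbreviation sdom :: "'a \<Rightarrow> 'a \<Rightarrow> bool" where "sdom \<equiv> strict_dominator G s"
abbreviation D :: "'a \<Rightarrow> 'a set" where "D \<equiv> descendants G s"
abbreviation Ch :: "'a \<Rightarrow> 'a set" where "Ch \<equiv> children G s"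
abbreviation avoids :: "'a \<Rightarrow> 'a \<Rightarrow> bool" where "avoids \<equiv> reach_avoiding (parcs G) s"

lemma verts_induct [consumes 1, case_names source arc]:
  assumes "v \<in> pverts G" "P s" "\<And>x y. (x, y) \<in> parcs G \<Longrightarrow> P x \<Longrightarrow> P y"
  shows "P v"
  using all_reachable[OF assms(1)]
proof (induction rule: reachable_induct)
  case (step x y)
  then show ?case using assms(3) by simp
qed (rule assms(2))

lemma avoids_iff_awalk:
  "avoids a b \<longleftrightarrow> (\<exists>p. awalk s p b \<and> a \<notin> set (pawalk_verts s p))"
proof
  assume "avoids a b"
  then show "\<exists>p. awalk s p b \<and> a \<notin> set (pawalk_verts s p)"
  proof induction
    case start
    then show ?case
      using source_in_verts by (intro exI[of _ "[]"]) (auto simp: awalk_Nil_iff)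
  next
    case (step x y)
    then obtain p where p: "awalk s p x" "a \<notin> set (pawalk_verts s p)" by blast
    have e: "awalk x [(x, y)] y"
      using step.hyps(2) in_arcsD1 in_arcsD2 by (auto simp: awalk_simps)
    have "awalk s (p @ [(x, y)]) y" using p(1) e by simp
    moreover have "a \<notin> set (pawalk_verts s (p @ [(x, y)]))"
      using set_awalk_verts_append[OF p(1) e] p(2) step.hyps not_reach_avoiding_self[of "parcs G" s a]
      by auto
    ultimately show ?case by blast
  qed
next
  \<comment> \<open>The start is generalised from \<open>s\<close> to any node already reached
    without \<open>a\<close>, so that the induction can consume arcs from the front.\<close>
  have "avoids a b" if "awalk u p b" "a \<notin> set (pawalk_verts u p)" "avoids a u" for u p
    using that
  proof (induction p arbitrary: u)
    case (Cons e p)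
    obtain x y where e: "e = (x, y)" by fastforce
    have p: "(x, y) \<in> parcs G" "u = x" "awalk y p b"
      using Cons.prems(1) e by (simp_all add: awalk_Cons_iff)
    then have "y \<in> set (pawalk_verts y p)" using set_awalk_verts by blast
    then have "y \<noteq> a" "a \<notin> set (pawalk_verts y p)" using Cons.prems(2) e by auto
    with Cons.prems(3) p have "avoids a y" by (blast intro: reach_avoiding.step)
    with Cons.IH p \<open>a \<notin> set (pawalk_verts y p)\<close> show ?case by blast
  qed (simp add: awalk_Nil_iff)
  moreover assume "\<exists>p. awalk s p b \<and> a \<notin> set (pawalk_verts s p)"
  then obtain p where p: "awalk s p b" "a \<notin> set (pawalk_verts s p)" by blast
  moreover have "s \<noteq> a" using set_awalk_verts[OF p(1)] p(2) by blast
  ultimately show "avoids a b" by (blast intro: reach_avoiding.start)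
qed

text \<open>Shortcutting a walk to a simple path only drops arcs, hence nodes, so the paths of the
  definition may be replaced by walks.\<close>

lemma dom_iff: "dom a b \<longleftrightarrow> a \<in> pverts G \<and> b \<in> pverts G \<and> \<not> avoids a b"
proof -
  have "(\<exists>p. apath s p b \<and> a \<notin> set (pawalk_verts s p)) \<longleftrightarrow>
        (\<exists>p. awalk s p b \<and> a \<notin> set (pawalk_verts s p))"
  proof
    assume "\<exists>p. awalk s p b \<and> a \<notin> set (pawalk_verts s p)"
    then obtain p where p: "awalk s p b" "a \<notin> set (pawalk_verts s p)" by blast
    let ?q = "awalk_to_apath p"
    have q: "apath s ?q b" using p(1) by (rule apath_awalk_to_apath)
    have sub: "set ?q \<subseteq> set p" using p(1) by (rule awalk_to_apath_subset)
    have v: "set (pawalk_verts s r) = {s} \<union> fst ` set r \<union> snd ` set r" if "awalk s r b" for r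
      using set_awalk_verts[OF that] by simp
    show "\<exists>p. apath s p b \<and> a \<notin> set (pawalk_verts s p)"
      using p v[OF p(1)] v[OF awalkI_apath[OF q]] q sub by blast
  qed (auto intro: awalkI_apath)
  then show ?thesis
    unfolding dominator_def avoids_iff_awalk by auto
qed

lemma dom_verts: "dom a b \<Longrightarrow> a \<in> pverts G \<and> b \<in> pverts G"
  by (simp add: dom_iff)

lemma dom_refl: "a \<in> pverts G \<Longrightarrow> dom a a"
  by (simp add: dom_iff not_reach_avoiding_self)

lemma dom_trans: "dom a b \<Longrightarrow> dom b c \<Longrightarrow> dom a c"
  unfolding dom_iff using reach_avoiding_cases_via[of "parcs G" s a c b] by blast

lemma dom_antisym:
  assumes "dom a b" "dom b a"
  shows "a = b"
proof (rule ccontr)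
  assume "a \<noteq> b"
  \<comment> \<open>Until one of \<open>a\<close>, \<open>b\<close> is met, both are avoided; the
    first one met is reached without the other. At \<open>c = a\<close> the first disjunct is
    impossible.\<close>
  have "(avoids a c \<and> avoids b c) \<or> avoids a b \<or> avoids b a" if "c \<in> pverts G" for c
    using that
  proof (induction rule: verts_induct)
    case source
    then show ?case using \<open>a \<noteq> b\<close> by (metis reach_avoiding.start)
  next
    case (arc x y)
    then show ?case using \<open>a \<noteq> b\<close> by (metis reach_avoiding.step)
  qed
  from this[of a] show False using assms not_reach_avoiding_self by (metis dom_iff)
qed

lemma dom_linear:
  assumes "dom a c" "dom b c"
  shows "dom a b \<or> dom b a"
proof (rule ccontr)
  assume "\<not> (dom a b \<or> dom b a)"
  with assms have av: "avoids a b" "avoids b a" by (auto simp: dom_iff)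
  then have "a \<noteq> b" using not_reach_avoiding_self by metis
  have "c \<in> pverts G" using assms(1) by (simp add: dom_iff)
  \<comment> \<open>On running into one of the two nodes, switch to the walk from \<open>av\<close>
    that reaches it without the other.\<close>
  then have "avoids a c \<or> avoids b c"
  proof (induction rule: verts_induct)
    case source
    then show ?case using \<open>a \<noteq> b\<close> by (metis reach_avoiding.start)
  next
    case (arc x y)
    then show ?case using av by (metis reach_avoiding.step)
  qed
  with assms show False by (auto simp: dom_iff)
qed

lemma source_dom: "a \<in> pverts G \<Longrightarrow> dom s a"
proof -
  have "\<not> avoids s a"
  proof
    assume "avoids s a"
    then show False by induction auto
  qed
  then show "a \<in> pverts G \<Longrightarrow> dom s a" using source_in_verts by (simp add: dom_iff)
qed

text \<open>A walk to \<open>x\<close> without \<open>v\<close> would extend to \<open>y\<close>.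
  Hence arcs from outside enter the subtree of \<open>v\<close> only at \<open>v\<close>.\<close>

lemma dom_pred:
  assumes "(x, y) \<in> parcs G" "dom v y" "v \<noteq> y"
  shows "dom v x"
  using assms in_arcsD1 by (auto simp: dom_iff intro: reach_avoiding.step)

section \<open>Children and descendants in the dominator tree\<close>

lemma children_iff: "v \<in> Ch a \<longleftrightarrow> sdom a v \<and> \<not> (\<exists>c. sdom a c \<and> sdom c v)"
  by (simp add: children_def dominator_tree_def)

lemma children_verts: "Ch a \<subseteq> pverts G"
  by (auto simp: children_iff strict_dominator_def dom_iff)

lemma descendants_iff: "b \<in> D a \<longleftrightarrow> dom a b"
proof
  let ?T = "with_proj (dominator_tree G s)"
  interpret T: pair_wf_digraph "dominator_tree G s"
    by unfold_locales (auto simp: dominator_tree_def strict_dominator_def dom_iff)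
  assume "b \<in> D a"
  then have "a \<rightarrow>\<^sup>*\<^bsub>?T\<^esub> b" by (simp add: descendants_def)
  then show "dom a b"
  proof (induction rule: T.reachable_induct)
    case base
    then show ?case by (simp add: dominator_tree_def dom_refl)
  next
    case (step x y)
    then have "dom x y" by (auto simp: dominator_tree_def strict_dominator_def)
    with step show ?case by (blast intro: dom_trans)
  qed
next
  let ?T = "with_proj (dominator_tree G s)"
  interpret T: pair_wf_digraph "dominator_tree G s"
    by unfold_locales (auto simp: dominator_tree_def strict_dominator_def dom_iff)
  assume "dom a b"
  then have "a \<rightarrow>\<^sup>*\<^bsub>?T\<^esub> b"
  \<comment> \<open>A node strictly between \<open>a\<close> and \<open>b\<close> splits the
    dominance interval into two smaller ones; without such a node, \<open>b\<close> is
    \<open>a\<close> or a child of \<open>a\<close>.\<close>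
  proof (induction "card {c. dom a c \<and> dom c b}" arbitrary: a b rule: less_induct)
    case less
    have fin: "finite {c. dom a c \<and> dom c b}"
      by (rule finite_subset[OF _ pair_finite_verts]) (auto simp: dom_iff)
    consider "a = b" | "b \<in> Ch a" | c where "sdom a c" "sdom c b"
      using less.prems by (auto simp: children_iff strict_dominator_def)
    then show ?case
    proof cases
      case 1
      then show ?thesis
        using less.prems T.reachable_refl[of a] by (simp add: dominator_tree_def dom_iff)
    next
      case 2
      then show ?thesis by (auto simp: children_def)
    next
      case 3
      then have c: "dom a c" "dom c b" "a \<noteq> c" "c \<noteq> b" by (auto simp: strict_dominator_def)
      have "{d. dom a d \<and> dom d c} \<subset> {d. dom a d \<and> dom d b}"
        using c less.prems dom_trans dom_antisym dom_refl dom_verts by blast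
      then have ac: "a \<rightarrow>\<^sup>*\<^bsub>?T\<^esub> c"
        using less.hyps c fin by (meson psubset_card_mono)
      have "{d. dom c d \<and> dom d b} \<subset> {d. dom a d \<and> dom d b}"
        using c less.prems dom_trans dom_antisym dom_refl dom_verts by blast
      then have "c \<rightarrow>\<^sup>*\<^bsub>?T\<^esub> b"
        using less.hyps c fin by (meson psubset_card_mono)
      with ac show ?thesis by (rule T.reachable_trans)
    qed
  qed
  then show "b \<in> D a" by (simp add: descendants_def)
qed

lemma descendants_verts: "D a \<subseteq> pverts G"
  by (auto simp: descendants_iff dom_iff)

lemma descendants_child_decomp:
  assumes "dom a b" "a \<noteq> b"
  obtains v where "v \<in> Ch a" "dom v b"
proof -
  let ?T = "with_proj (dominator_tree G s)"
  have "a \<rightarrow>\<^sup>*\<^bsub>?T\<^esub> b" using assms(1) descendants_iff by (auto simp: descendants_def)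
  then obtain v where "a \<rightarrow>\<^bsub>?T\<^esub> v" "v \<rightarrow>\<^sup>*\<^bsub>?T\<^esub> b"
    using assms(2) by (cases rule: pre_digraph.converse_reachable_cases) auto
  then have "v \<in> Ch a" "v \<in> {v. b \<in> D v}" by (auto simp: children_def descendants_def)
  then show thesis using that descendants_iff by auto
qed

lemma child_dom: "v \<in> Ch a \<Longrightarrow> dom a v \<and> a \<noteq> v"
  by (simp add: children_iff strict_dominator_def)

text \<open>The dominators of \<open>v\<close> form a chain, so \<open>m\<close> is comparable with
  \<open>a\<close>, and nothing lies strictly between \<open>a\<close> and its child.\<close>

lemma dom_child_cases:
  assumes "v \<in> Ch a" "dom m v"
  shows "m = v \<or> dom m a"
proof (rule ccontr)
  assume n: "\<not> (m = v \<or> dom m a)"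
  then have "dom a m" using assms dom_linear child_dom by blast
  with n have "sdom a m" "sdom m v"
    using assms dom_refl dom_verts by (auto simp: strict_dominator_def)
  then show False using assms(1) by (auto simp: children_iff)
qed

text \<open>Dominators of \<open>x\<close> are comparable, and a sibling strictly above the other
  would dominate the parent \<open>a\<close>. So siblings have disjoint subtrees.\<close>

lemma child_unique:
  assumes "u \<in> Ch a" "v \<in> Ch a" "dom u x" "dom v x"
  shows "u = v"
proof -
  have "dom u v \<or> dom v u" using assms dom_linear by blast
  then show ?thesis
    using assms dom_child_cases child_dom dom_antisym by metis
qed

section \<open>Modules\<close>

lemma module_source_dom:
  assumes "is_module G s M"
  shows "\<exists>m\<in>M. M \<subseteq> pverts G \<and> (\<forall>x\<in>M. dom m x) \<and>
    (\<forall>x y. (x, y) \<in> parcs G \<longrightarrow> x \<notin> M \<longrightarrow> y \<in> M \<longrightarrow> y = m) \<and>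
    (\<forall>x\<in>M. \<forall>u. dom u x \<longrightarrow> u \<notin> M \<longrightarrow> dom u m)"
proof -
  obtain m where m: "M \<subseteq> pverts G" "m \<in> M" "s \<in> M \<Longrightarrow> m = s"
      "\<And>x y. (x, y) \<in> parcs G \<Longrightarrow> x \<notin> M \<Longrightarrow> y \<in> M \<Longrightarrow> y = m"
    using assms by (auto simp: is_module_def module_with_source_def split: if_splits)
  \<comment> \<open>A walk without \<open>m\<close> cannot enter \<open>M\<close>, whose only
    entrance is \<open>m\<close>, nor start there, since \<open>s \<in> M\<close> forces
    \<open>m = s\<close>.\<close>
  have "x \<notin> M" if "avoids m x" for x
    using that by induction (use m in auto)
  then have 1: "dom m x" if "x \<in> M" for x
    using that m(1,2) by (auto simp: dom_iff)
  \<comment> \<open>A node of \<open>M\<close> entered from outside is \<open>m\<close>, reached by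
    assumption; one entered from within \<open>M\<close> extends a walk without \<open>u\<close>, as
    \<open>u\<close> lies outside.\<close>
  have "avoids u x" if "x \<in> M" "u \<notin> M" "avoids u m" for u x
  proof -
    have "x \<in> pverts G" using that m by auto
    then have "x \<in> M \<longrightarrow> avoids u x"
      by (induction rule: verts_induct) (use that m(3,4) in \<open>metis reach_avoiding.step\<close>)+
    with that show ?thesis by blast
  qed
  then have 2: "dom u m" if "x \<in> M" "dom u x" "u \<notin> M" for u x
    using that m(1,2) by (auto simp: dom_iff)
  show ?thesis using m(1,2,4) 1 2 by (intro bexI[of _ m] conjI) blast+
qed

lemma child_graph_wf: "pair_wf_digraph (child_graph G s a)"
  by unfold_locales (auto simp: child_graph_def)

text \<open>If the head lay strictly below \<open>v\<close>, then by \<open>dom_pred\<close> the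
  tail would lie below \<open>v\<close> as well as below its sibling \<open>u\<close>. So the head
  is \<open>v\<close> itself.\<close>

lemma child_graph_arc:
  assumes "(u, v) \<in> parcs (child_graph G s a)"
  obtains x where "(x, v) \<in> parcs G" "dom u x" "u \<in> Ch a" "v \<in> Ch a"
proof -
  obtain x y where xy: "(x, y) \<in> parcs G" "dom u x" "dom v y" "u \<in> Ch a" "v \<in> Ch a" "u \<noteq> v"
    using assms by (auto simp: child_graph_def descendants_iff)
  have "v = y"
  proof (rule ccontr)
    assume "v \<noteq> y"
    then have "dom v x" using xy dom_pred by blast
    with xy child_unique show False by blast
  qed
  with xy that show thesis by blast
qed

end

text \<open>A path inside \<open>C\<close> from \<open>u\<close> to \<open>v\<close> must cross into
  \<open>T\<close> somewhere.\<close>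

lemma scc_arc_into_subset:
  assumes "pair_wf_digraph H" "C \<in> pre_digraph.sccs_verts (with_proj H)"
    and "u \<in> C - T" "v \<in> C \<inter> T"
  obtains x y where "x \<in> C - T" "y \<in> C \<inter> T" "(x, y) \<in> parcs H"
proof -
  interpret H: pair_wf_digraph H by fact
  have C: "\<And>x y. x \<in> C \<Longrightarrow> y \<in> C \<Longrightarrow> x \<rightarrow>\<^sup>*\<^bsub>with_proj H\<^esub> y"
      "\<And>x y. x \<in> C \<Longrightarrow> x \<rightarrow>\<^sup>*\<^bsub>with_proj H\<^esub> y \<Longrightarrow> y \<rightarrow>\<^sup>*\<^bsub>with_proj H\<^esub> x \<Longrightarrow> y \<in> C"
    using assms(2) unfolding H.in_sccs_verts_conv_reachable by blast+
  have "u \<rightarrow>\<^sup>*\<^bsub>with_proj H\<^esub> v" using C(1) assms(3,4) by blast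
  then have "u \<in> C - T \<longrightarrow> (\<exists>x \<in> C - T. \<exists>y \<in> C \<inter> T. (x, y) \<in> parcs H)"
  proof (induction rule: H.converse_reachable_induct)
    case base
    then show ?case using assms(4) by blast
  next
    case (step x y)
    \<comment> \<open>The path cannot leave \<open>C\<close>: \<open>y\<close> reaches
      \<open>v\<close>, and \<open>v\<close> reaches \<open>x\<close> within the component.\<close>
    have "y \<in> C" if "x \<in> C"
    proof -
      have "v \<rightarrow>\<^sup>*\<^bsub>with_proj H\<^esub> x" using C(1) assms(4) that by blast
      with step.hyps have "y \<rightarrow>\<^sup>*\<^bsub>with_proj H\<^esub> x" by (blast intro: H.reachable_trans)
      with step.hyps that show ?thesis using C(2) by blast
    qed
    then show ?case using step by auto
  qed
  with assms(3) that show thesis by blast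
qed

context source_digraph
begin

text \<open>One of the two elements is a child of \<open>a\<close> other than the source
  \<open>m\<close> of \<open>H\<close>, so \<open>m\<close> dominates \<open>a\<close>. This forces
  \<open>a\<close> into \<open>H\<close>, and then all of \<open>C\<close> by strong
  connectivity.\<close>

lemma module_contains_scc:
  assumes "is_module G s H" "C \<in> pre_digraph.sccs_verts (with_proj (child_graph G s a))"
    and "x \<in> insert a C" "y \<in> insert a C" "x \<noteq> y" "x \<in> H" "y \<in> H"
  shows "insert a C \<subseteq> H"
proof -
  interpret A: pair_wf_digraph "child_graph G s a" by (rule child_graph_wf)
  have C: "C \<subseteq> Ch a"
    using A.sccs_verts_subsets[OF assms(2)] by (simp add: child_graph_def)
  obtain m where m: "m \<in> H" "H \<subseteq> pverts G" "\<forall>x\<in>H. dom m x"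
      "\<forall>x y. (x, y) \<in> parcs G \<longrightarrow> x \<notin> H \<longrightarrow> y \<in> H \<longrightarrow> y = m"
      "\<forall>x\<in>H. \<forall>u. dom u x \<longrightarrow> u \<notin> H \<longrightarrow> dom u m"
    using module_source_dom[OF assms(1)] by auto
  \<comment> \<open>If \<open>x\<close> or \<open>y\<close> is \<open>a\<close>, the other one
    serves: it cannot be \<open>m\<close>, which dominates \<open>a\<close>. If both lie in
    \<open>C\<close>, at most one of them is \<open>m\<close>.\<close>
  obtain v where v: "v \<in> C" "v \<in> H" "v \<noteq> m" "x = a \<or> y = a \<or> dom m a"
    using assms(3-7) m(3) C dom_child_cases child_dom dom_antisym by (metis insertE subsetD)
  have "dom m a" using dom_child_cases v C m(3) by blast
  have "a \<in> H"
  proof (rule ccontr)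
    assume "a \<notin> H"
    then have "dom a m" using m(5) v C child_dom by blast
    then show False using \<open>dom m a\<close> \<open>a \<notin> H\<close> m(1) dom_antisym by blast
  qed
  moreover have "C \<subseteq> H"
  proof
    fix u assume "u \<in> C"
    show "u \<in> H"
    proof (rule ccontr)
      assume "u \<notin> H"
      \<comment> \<open>The arc of \<open>G\<close> behind this one ends at
        \<open>z \<noteq> m\<close>, so its tail \<open>p\<close> lies in \<open>H\<close>; then
        \<open>w\<close>, a dominator of \<open>p\<close> outside \<open>H\<close>, would have to
        dominate \<open>m\<close>.\<close>
      then obtain w z where wz: "w \<in> C - H" "z \<in> C \<inter> H"
          "(w, z) \<in> parcs (child_graph G s a)"
        using scc_arc_into_subset[OF child_graph_wf assms(2)] \<open>u \<in> C\<close> v by blast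
      then obtain p where p: "(p, z) \<in> parcs G" "dom w p" "w \<in> Ch a"
        using child_graph_arc by metis
      have nw: "\<not> dom w m"
        using \<open>dom m a\<close> dom_trans child_dom[OF p(3)] dom_antisym by blast
      have "z \<noteq> m"
        using \<open>dom m a\<close> wz C child_dom dom_antisym by blast
      then have "p \<in> H" using m(4) p(1) wz by blast
      then show False using m(5) p(2) wz nw by blast
    qed
  qed
  ultimately show ?thesis by blast
qed

section \<open>The lower bound on the width of any nesting decomposition\<close>

lemma finite_nesting_decomposition:
  assumes "nesting_decomposition G s F"
  shows "F \<subseteq> Pow (pverts G)" "finite F"
proof -
  show "F \<subseteq> Pow (pverts G)"
  proof
    fix M assume "M \<in> F"
    then have "is_module G s M" using assms by (simp add: nesting_decomposition_def)
    from module_source_dom[OF this] show "M \<in> Pow (pverts G)" by auto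
  qed
  then show "finite F" using pair_finite_verts by (simp add: finite_subset)
qed

text \<open>The singleton of \<open>x\<close> belongs to \<open>F\<close>, so proper submembers
  containing \<open>x\<close> exist; a maximal one is a part.\<close>

lemma module_part_covers:
  assumes "nesting_decomposition G s F" "M \<in> F" "x \<in> M" "M \<noteq> {x}"
  obtains H where "H \<in> maximal_module_partition F M" "x \<in> H"
proof -
  note fin = finite_nesting_decomposition[OF assms(1)]
  let ?K = "{H \<in> F. x \<in> H \<and> H \<subset> M}"
  have "x \<in> pverts G" using assms(2,3) fin(1) by blast
  then have "{x} \<in> F" using assms(1) by (auto simp: nesting_decomposition_def trivial_modules_def)
  then have "{x} \<in> ?K" using assms(3,4) by blast
  then have K: "finite ?K" "?K \<noteq> {}" using fin(2) by auto
  then obtain H where "H \<in> ?K" "\<forall>K\<in>?K. H \<subseteq> K \<longrightarrow> H = K"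
    using finite_has_maximal[OF K] by blast
  then have "H \<in> maximal_module_partition F M" "x \<in> H"
    by (auto simp: maximal_module_partition_def)
  then show thesis by (rule that)
qed

lemma width_ge_scc:
  assumes F: "nesting_decomposition G s F" and a: "a \<in> pverts G"
    and C: "C \<in> pre_digraph.sccs_verts (with_proj (child_graph G s a))"
  shows "1 + card C \<le> decomposition_width F"
proof -
  interpret A: pair_wf_digraph "child_graph G s a" by (rule child_graph_wf)
  have CCh: "C \<subseteq> Ch a" "C \<noteq> {}"
    using A.sccs_verts_subsets[OF C] C
    by (simp_all add: child_graph_def pre_digraph.sccs_verts_def)
  have aC: "a \<notin> C" using CCh child_dom by blast
  have finC: "finite C" using CCh children_verts pair_finite_verts finite_subset by metis
  note finF = finite_nesting_decomposition[OF F]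
  let ?K = "{M \<in> F. insert a C \<subseteq> M}"
  have "pverts G \<in> ?K"
    using F a CCh children_verts by (auto simp: nesting_decomposition_def trivial_modules_def)
  then have K: "finite ?K" "?K \<noteq> {}" using finF(2) by auto
  then obtain M where M: "M \<in> ?K" and min: "\<forall>K\<in>?K. K \<subseteq> M \<longrightarrow> M = K"
    using finite_has_minimal[OF K] by blast
  let ?P = "maximal_module_partition F M"
  have "\<exists>H\<in>?P. x \<in> H" if "x \<in> insert a C" for x
  proof (rule module_part_covers[OF F, of M x])
    show "M \<noteq> {x}" using M CCh aC by blast
  qed (use that M in auto)
  then obtain f where f: "\<And>x. x \<in> insert a C \<Longrightarrow> f x \<in> ?P \<and> x \<in> f x" by metis
  \<comment> \<open>A part with two elements of \<open>insert a C\<close> would contain all of it,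
    against the minimality of \<open>M\<close>.\<close>
  have "inj_on f (insert a C)"
  proof (rule inj_onI, rule ccontr)
    fix x y assume xy: "x \<in> insert a C" "y \<in> insert a C" "f x = f y" "x \<noteq> y"
    have fx: "f x \<in> F" "f x \<subset> M"
      using f[OF xy(1)] by (auto simp: maximal_module_partition_def)
    have "is_module G s (f x)" using F fx by (auto simp: nesting_decomposition_def)
    then have "insert a C \<subseteq> f x" using module_contains_scc[OF _ C xy(1,2,4)] f xy by metis
    with fx min show False by blast
  qed
  moreover have "f ` insert a C \<subseteq> ?P" using f by blast
  moreover have "finite ?P" using finF by (simp add: maximal_module_partition_def)
  ultimately have "card (insert a C) \<le> card ?P" by (metis card_inj_on_le)
  also have "card ?P \<le> decomposition_width F"
    unfolding decomposition_width_def using finF M by (intro Max_ge) auto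
  finally show ?thesis using aC finC by simp
qed

end

section \<open>The A-C decomposition\<close>

locale ac_tree_digraph = source_digraph +
  fixes S :: "'a \<Rightarrow> 'a set list"
  assumes AC_tree: "AC_tree G s S"
begin

text \<open>Admitting \<open>j = 0\<close> yields the singletons, so that one formula describes
  every member of the decomposition.\<close>

definition initial_set :: "'a \<Rightarrow> nat \<Rightarrow> 'a set" where
  "initial_set a j = {a} \<union> (\<Union>i\<in>{1..j}. descendants_of_set G s (S a ! (i - 1)))"

lemma mem_initial_set:
  "x \<in> initial_set a j \<longleftrightarrow> x = a \<or> (\<exists>i<j. \<exists>v \<in> S a ! i. dom v x)"
proof -
  have *: "(\<exists>i\<in>{1..j}. P (i - 1)) \<longleftrightarrow> (\<exists>i<j. P i)" for P :: "nat \<Rightarrow> bool"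
  proof
    assume "\<exists>i<j. P i"
    then obtain i where "i < j" "P i" by blast
    then show "\<exists>i\<in>{1..j}. P (i - 1)" by (intro bexI[of _ "Suc i"]) auto
  next
    assume "\<exists>i\<in>{1..j}. P (i - 1)"
    then obtain i where "i \<in> {1..j}" "P (i - 1)" by blast
    then show "\<exists>i<j. P i" by (intro exI[of _ "i - 1"]) auto
  qed
  have "x \<in> initial_set a j \<longleftrightarrow> x = a \<or> (\<exists>i\<in>{1..j}. \<exists>v \<in> S a ! (i - 1). dom v x)"
    by (simp add: initial_set_def descendants_of_set_def descendants_iff)
  then show ?thesis by (simp only: *[of "\<lambda>i. \<exists>v \<in> S a ! i. dom v x"])
qed

lemma initial_set_0: "initial_set a 0 = {a}"
  by (simp add: initial_set_def)

lemma initial_set_mono: "i \<le> j \<Longrightarrow> initial_set a i \<subseteq> initial_set a j"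
  unfolding subset_iff mem_initial_set by (meson less_le_trans)

section \<open>Components and initial sets at one node\<close>

context
  fixes a assumes a: "a \<in> pverts G"
begin

lemma component_scc:
  "C \<in> set (S a) \<longleftrightarrow> C \<in> pre_digraph.sccs_verts (with_proj (child_graph G s a))"
  using AC_tree a by (simp add: AC_tree_def topological_scc_list_def)

lemma component_nonempty: "i < length (S a) \<Longrightarrow> S a ! i \<noteq> {}"
  using component_scc[of "S a ! i"] by (simp add: pre_digraph.sccs_verts_def)

lemma component_children: "i < length (S a) \<Longrightarrow> S a ! i \<subseteq> Ch a"
proof -
  interpret A: pair_wf_digraph "child_graph G s a" by (rule child_graph_wf)
  show "i < length (S a) \<Longrightarrow> S a ! i \<subseteq> Ch a"
    using A.sccs_verts_subsets component_scc[of "S a ! i"] by (simp add: child_graph_def)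
qed

lemma children_component:
  assumes "v \<in> Ch a"
  obtains i where "i < length (S a)" "v \<in> S a ! i"
proof -
  interpret A: pair_wf_digraph "child_graph G s a" by (rule child_graph_wf)
  have "v \<in> A.scc_of v" "A.scc_of v \<in> set (S a)"
    using A.in_scc_of_self[of v] A.scc_of_in_sccs_verts[of v] assms component_scc
    by (auto simp: child_graph_def)
  then show thesis using that by (metis in_set_conv_nth)
qed

lemma component_unique:
  assumes "i < length (S a)" "j < length (S a)" "v \<in> S a ! i" "v \<in> S a ! j"
  shows "i = j"
proof -
  interpret A: pair_wf_digraph "child_graph G s a" by (rule child_graph_wf)
  have "S a ! i = S a ! j"
    using A.sccs_verts_disjoint[of "S a ! i" "S a ! j"] component_scc assms by (meson disjoint_iff nth_mem)
  then show ?thesis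
    using AC_tree a assms by (simp add: AC_tree_def topological_scc_list_def nth_eq_iff_index_eq)
qed

lemma component_arc_le:
  assumes "i < length (S a)" "j < length (S a)" "u \<in> S a ! i" "v \<in> S a ! j"
    and "(u, v) \<in> parcs (child_graph G s a)"
  shows "i \<le> j"
proof (rule ccontr)
  assume "\<not> i \<le> j"
  then have "j < i" by simp
  then show False using AC_tree a assms unfolding AC_tree_def topological_scc_list_def by blast
qed

text \<open>A strict descendant of \<open>a\<close> lies below a child, and every child lies in some
  component.\<close>

lemma initial_set_length: "initial_set a (length (S a)) = D a"
proof
  show "initial_set a (length (S a)) \<subseteq> D a"
  proof
    fix x assume "x \<in> initial_set a (length (S a))"
    then consider "x = a" | i v where "i < length (S a)" "v \<in> S a ! i" "dom v x"
      by (auto simp: mem_initial_set)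
    then have "dom a x"
    proof cases
      case 1
      then show ?thesis using a dom_refl by simp
    next
      case 2
      then show ?thesis using component_children child_dom dom_trans by blast
    qed
    then show "x \<in> D a" by (simp add: descendants_iff)
  qed
  show "D a \<subseteq> initial_set a (length (S a))"
  proof
    fix b assume "b \<in> D a"
    then have "dom a b" by (simp add: descendants_iff)
    show "b \<in> initial_set a (length (S a))"
    proof (cases "a = b")
      case False
      then obtain v where "v \<in> Ch a" "dom v b"
        using \<open>dom a b\<close> descendants_child_decomp by blast
      then show ?thesis using children_component mem_initial_set by metis
    qed (simp add: mem_initial_set)
  qed
qed

lemma initial_set_subset: "j \<le> length (S a) \<Longrightarrow> initial_set a j \<subseteq> D a"
  using initial_set_mono initial_set_length by blast

text \<open>By \<open>child_unique\<close>, the component element above \<open>b\<close> is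
  \<open>v\<close>. So an initial set takes the subtree of a child whole or not at all.\<close>

lemma descendants_in_initial_set:
  assumes "j \<le> length (S a)" "v \<in> Ch a" "dom v b" "b \<in> initial_set a j"
  obtains i where "i < j" "v \<in> S a ! i" "D v \<subseteq> initial_set a j"
proof -
  have "a \<noteq> b" using assms child_dom dom_antisym by blast
  then obtain i u where u: "i < j" "u \<in> S a ! i" "dom u b"
    using assms(4) by (auto simp: mem_initial_set)
  then have "u = v" using child_unique assms component_children by (metis less_le_trans subsetD)
  moreover from this have "D v \<subseteq> initial_set a j"
    using u by (auto simp: mem_initial_set descendants_iff)
  ultimately show thesis using u that by blast
qed

text \<open>An arc entering at \<open>y \<noteq> a\<close> starts below \<open>a\<close>, in the
  subtree of a child from a later component. It induces an arc of the child graph against the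
  topological order.\<close>

lemma initial_set_module:
  assumes j: "j \<le> length (S a)"
  shows "module_with_source G a (initial_set a j)"
  unfolding module_with_source_def
proof (intro conjI allI impI)
  show "initial_set a j \<subseteq> pverts G"
    using initial_set_subset[OF j] descendants_verts by blast
  show "a \<in> initial_set a j" by (simp add: mem_initial_set)
  fix x y assume xy: "(x, y) \<in> parcs G \<and> x \<notin> initial_set a j \<and> y \<in> initial_set a j"
  show "y = a"
  proof (rule ccontr)
    assume "y \<noteq> a"
    then obtain i v where v: "i < j" "v \<in> S a ! i" "dom v y"
      using xy by (auto simp: mem_initial_set)
    have vc: "v \<in> Ch a" using v j component_children by (meson less_le_trans subsetD)
    have nvx: "\<not> dom v x" using v xy by (auto simp: mem_initial_set)
    have ay: "dom a y" using vc v dom_trans child_dom by blast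
    have "dom a x" using dom_pred ay \<open>y \<noteq> a\<close> xy by blast
    moreover have "a \<noteq> x" using xy by (auto simp: mem_initial_set)
    ultimately obtain u where u: "u \<in> Ch a" "dom u x" by (rule descendants_child_decomp)
    obtain k where k: "k < length (S a)" "u \<in> S a ! k" using u(1) children_component by blast
    have "\<not> k < j" using xy u k by (auto simp: mem_initial_set)
    moreover have "(u, v) \<in> parcs (child_graph G s a)"
      using u vc nvx v xy \<open>dom a x\<close> ay by (auto simp: child_graph_def descendants_iff)
    then have "k \<le> i" using component_arc_le k v j by simp
    ultimately show False using v by simp
  qed
qed

end

section \<open>The A-C family as a nesting decomposition\<close>

lemma AC_trivial_eq:
  "AC_family G s S \<union> trivial_modules G =
     {initial_set a j | a j. a \<in> pverts G \<and> j \<le> length (S a)}" (is "?L = ?R")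
proof
  \<comment> \<open>This makes the node set the full initial set of \<open>s\<close>, even when
    \<open>s\<close> is the only node and its list is empty.\<close>
  have "pverts G = D s"
    using source_dom descendants_verts by (auto simp: descendants_iff)
  then have "pverts G \<in> ?R" using initial_set_length source_in_verts by blast
  moreover have "{v} \<in> ?R" if "v \<in> pverts G" for v
    using that initial_set_0[of v] by (metis (mono_tags, lifting) le0 mem_Collect_eq)
  moreover have "AC_family G s S \<subseteq> ?R"
    by (auto simp: AC_family_def initial_set_def)
  ultimately show "?L \<subseteq> ?R" by (auto simp: trivial_modules_def)
  show "?R \<subseteq> ?L"
  proof
    fix M assume "M \<in> ?R"
    then obtain a j where M: "M = initial_set a j" "a \<in> pverts G" "j \<le> length (S a)" by blast
    show "M \<in> ?L"
    proof (cases "j = 0")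
      case True
      then show ?thesis using M initial_set_0 by (auto simp: trivial_modules_def)
    next
      case False
      then have "j \<in> {1..length (S a)}" using M by simp
      then show ?thesis using M unfolding AC_family_def initial_set_def by blast
    qed
  qed
qed

lemma initial_sets_nested:
  assumes "a \<in> pverts G" "j \<le> length (S a)" "b \<in> pverts G" "i \<le> length (S b)"
  shows "initial_set a j \<inter> initial_set b i = {} \<or>
    initial_set a j \<subseteq> initial_set b i \<or> initial_set b i \<subseteq> initial_set a j"
proof -
  \<comment> \<open>The set at \<open>b\<close> lies in the subtree of one child of
    \<open>a\<close>, which the set at \<open>a\<close> either contains or misses.\<close>
  have *: "initial_set a j \<inter> initial_set b i = {} \<or> initial_set b i \<subseteq> initial_set a j"
    if ab: "dom a b" "a \<noteq> b" "a \<in> pverts G" "j \<le> length (S a)" "b \<in> pverts G" "i \<le> length (S b)"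
    for a b i j
  proof -
    obtain v where v: "v \<in> Ch a" "dom v b" using ab descendants_child_decomp by blast
    have sub: "initial_set b i \<subseteq> D v"
      using initial_set_subset[OF ab(5,6)] v dom_trans by (auto simp: descendants_iff)
    show ?thesis
    proof (cases "initial_set a j \<inter> D v = {}")
      case False
      then have "D v \<subseteq> initial_set a j"
        using descendants_in_initial_set[OF ab(3,4) v(1)] descendants_iff by blast
      then show ?thesis using sub by blast
    qed (use sub in blast)
  qed
  consider "a = b" | "dom a b" "a \<noteq> b" | "dom b a" "a \<noteq> b" | "\<not> dom a b" "\<not> dom b a" by blast
  then show ?thesis
  proof cases
    case 1
    then show ?thesis using initial_set_mono by (metis nat_le_linear)
  next
    case 2
    then show ?thesis using * assms by blast
  next
    case 3
    then show ?thesis using *[of b a i j] assms by blast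
  next
    \<comment> \<open>Incomparable nodes have disjoint subtrees by
      \<open>dom_linear\<close>.\<close>
    case 4
    then show ?thesis
      using initial_set_subset assms dom_linear by (fastforce simp: descendants_iff)
  qed
qed

lemma AC_nesting: "nesting_decomposition G s (AC_family G s S \<union> trivial_modules G)"
  unfolding nesting_decomposition_def
proof (intro conjI ballI)
  fix M assume "M \<in> AC_family G s S \<union> trivial_modules G"
  then obtain a j where M: "M = initial_set a j" "a \<in> pverts G" "j \<le> length (S a)"
    unfolding AC_trivial_eq by blast
  \<comment> \<open>A module containing \<open>s\<close> must have source \<open>s\<close>; here the
    source is \<open>a\<close>, which dominates all of \<open>M\<close>.\<close>
  have "a = s" if "s \<in> M"
  proof -
    have "dom a s" using that M(1) initial_set_subset[OF M(2,3)] by (auto simp: descendants_iff)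
    then show ?thesis using source_dom M dom_antisym by blast
  qed
  then show "is_module G s M"
    using initial_set_module[OF M(2,3)] M(1) by (auto simp: is_module_def)
next
  fix M N assume "M \<in> AC_family G s S \<union> trivial_modules G" "N \<in> AC_family G s S \<union> trivial_modules G"
  then show "M \<inter> N = {} \<or> M \<subseteq> N \<or> N \<subseteq> M"
    unfolding AC_trivial_eq using initial_sets_nested by blast
qed simp

section \<open>The width of the A-C decomposition\<close>

lemma AC_partition_le:
  assumes a: "a \<in> pverts G" and j: "Suc j \<le> length (S a)"
  shows "maximal_module_partition (AC_family G s S \<union> trivial_modules G) (initial_set a (Suc j))
    \<subseteq> insert (initial_set a j) (D ` (S a ! j))"
proof
  let ?F = "AC_family G s S \<union> trivial_modules G"
  let ?M = "initial_set a (Suc j)"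
  fix H assume "H \<in> maximal_module_partition ?F ?M"
  then have H: "H \<in> ?F" "H \<subset> ?M" and max: "\<And>K. K \<in> ?F \<Longrightarrow> H \<subseteq> K \<Longrightarrow> K \<subset> ?M \<Longrightarrow> H = K"
    by (auto simp: maximal_module_partition_def)
  obtain b i where b: "H = initial_set b i" "b \<in> pverts G" "i \<le> length (S b)"
    using H(1) unfolding AC_trivial_eq by blast
  have j_F: "initial_set a j \<in> ?F" unfolding AC_trivial_eq using a j Suc_leD by blast
  have j_sub: "initial_set a j \<subset> ?M"
  proof -
    obtain v where v: "v \<in> S a ! j" using component_nonempty[OF a] j by fastforce
    then have vc: "v \<in> Ch a" using component_children[OF a] j by (meson Suc_le_lessD subsetD)
    then have "dom v v" using children_verts dom_refl by blast
    then have "v \<in> ?M" using v by (auto simp: mem_initial_set)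
    moreover have "v \<notin> initial_set a j"
    proof
      assume "v \<in> initial_set a j"
      then obtain i where "i < j" "v \<in> S a ! i"
        using descendants_in_initial_set[OF a _ vc \<open>dom v v\<close>] j by (metis Suc_leD)
      then show False using v component_unique[OF a, of i j v] j by simp
    qed
    ultimately show ?thesis using initial_set_mono[of j "Suc j" a] by auto
  qed
  show "H \<in> insert (initial_set a j) (D ` (S a ! j))"
  proof (cases "b = a")
    case True
    \<comment> \<open>A larger index would make \<open>H\<close> contain \<open>?M\<close>.\<close>
    then have "i < Suc j" using H(2) b(1) initial_set_mono by (metis not_less psubset_eq subset_antisym)
    then have "H \<subseteq> initial_set a j" using b(1) True initial_set_mono by simp
    then show ?thesis using max j_F j_sub by blast
  next
    case False
    have "b \<in> H" using b(1) by (simp add: mem_initial_set)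
    then have "b \<in> ?M" using H(2) by blast
    then obtain k v where v: "k < Suc j" "v \<in> S a ! k" "dom v b"
      using False by (auto simp: mem_initial_set)
    have vc: "v \<in> Ch a" using component_children[OF a] v j by (meson less_le_trans subsetD)
    have HD: "H \<subseteq> D v"
      using initial_set_subset[OF b(2,3)] b(1) v(3) dom_trans by (auto simp: descendants_iff)
    show ?thesis
    proof (cases "k < j")
      case True
      \<comment> \<open>For an earlier component, \<open>H\<close> lies in the member
        \<open>initial_set a j\<close>, properly inside \<open>?M\<close>, so maximality makes them
        equal.\<close>
      then have "D v \<subseteq> initial_set a j" using v by (auto simp: mem_initial_set descendants_iff)
      then show ?thesis using HD max j_F j_sub by blast
    next
      case False
      then have "k = j" using v by simp
      \<comment> \<open>For the last component, \<open>D v\<close> is a member, being a full initial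
        set, and it is proper as it misses \<open>a\<close>; maximality gives
        \<open>H = D v\<close>.\<close>
      have "D v \<in> ?F"
        unfolding AC_trivial_eq using initial_set_length[of v] vc children_verts by blast
      moreover have "D v \<subset> ?M"
      proof -
        have "D v \<subseteq> ?M" using v by (auto simp: mem_initial_set descendants_iff)
        moreover have "a \<in> ?M" "a \<notin> D v"
          using vc child_dom dom_antisym by (auto simp: mem_initial_set descendants_iff)
        ultimately show ?thesis by blast
      qed
      ultimately have "H = D v" using HD max by blast
      then show ?thesis using v \<open>k = j\<close> by blast
    qed
  qed
qed

text \<open>Each partition has at most one part more than its last component has elements, and
  \<open>width_ge_scc\<close> bounds that number by the width of \<open>F\<close>.\<close>

lemma AC_width_le:
  assumes F: "nesting_decomposition G s F"
  shows "decomposition_width (AC_family G s S \<union> trivial_modules G) \<le> decomposition_width F"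
proof -
  let ?F = "AC_family G s S \<union> trivial_modules G"
  have "card (maximal_module_partition ?F M) \<le> decomposition_width F" if mem: "M \<in> ?F" for M
  proof -
    obtain a j where M: "M = initial_set a j" "a \<in> pverts G" "j \<le> length (S a)"
      using mem unfolding AC_trivial_eq by blast
    show ?thesis
    proof (cases j)
      case 0
      \<comment> \<open>For \<open>j = 0\<close> the member is a singleton, whose only proper subset
        is empty.\<close>
      have "{} \<notin> ?F" unfolding AC_trivial_eq by (auto simp: initial_set_def)
      then have "maximal_module_partition ?F M = {}"
        using M(1) 0 by (auto simp: maximal_module_partition_def initial_set_0 psubset_eq subset_singleton_iff)
      then show ?thesis by simp
    next
      case (Suc i)
      let ?C = "S a ! i"
      have i: "i < length (S a)" using Suc M by simp
      have fin: "finite ?C"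
        using component_children[OF M(2) i] children_verts pair_finite_verts finite_subset by metis
      have "card (maximal_module_partition ?F M) \<le> card (insert (initial_set a i) (D ` ?C))"
        using AC_partition_le[OF M(2)] M Suc fin by (auto intro!: card_mono)
      also have "\<dots> \<le> 1 + card ?C"
        using card_insert_le_m1[of _ "D ` ?C"] card_image_le[OF fin, of D]
        by (simp add: card_insert_if fin le_SucI)
      also have "\<dots> \<le> decomposition_width F"
        using width_ge_scc[OF F M(2)] component_scc[OF M(2), of ?C] i by simp
      finally show ?thesis .
    qed
  qed
  moreover have "finite ?F" "?F \<noteq> {}"
    using finite_nesting_decomposition[OF AC_nesting] by (auto simp: trivial_modules_def)
  ultimately show ?thesis
    unfolding decomposition_width_def[of ?F] by (auto intro!: Max.boundedI)
qed

end

theorem theorem1: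
  fixes G :: "'a pair_pre_digraph" and s :: 'a and S :: "'a \<Rightarrow> 'a set list"
  assumes "source_digraph G s"
    and "AC_tree G s S"
  shows "nesting_decomposition G s (AC_family G s S \<union> trivial_modules G) \<and>
         decomposition_width (AC_family G s S \<union> trivial_modules G) = nesting_width G s"
proof -
  interpret source_digraph G s by fact
  interpret ac_tree_digraph G s S by unfold_locales fact
  \<comment> \<open>\<open>Min\<close> needs finitely many candidates; they are families of subsets
    of a finite node set.\<close>
  have "{F. nesting_decomposition G s F} \<subseteq> Pow (Pow (pverts G))"
    using finite_nesting_decomposition by blast
  then have "finite {F. nesting_decomposition G s F}"
    using pair_finite_verts by (simp add: finite_subset)
  then have "nesting_width G s = decomposition_width (AC_family G s S \<union> trivial_modules G)"
    unfolding nesting_width_def using AC_nesting AC_width_le by (intro Min_eqI) auto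
  then show ?thesis using AC_nesting by simp
qed

end
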